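(* Let $\mathbf n$ be a sequence with arbitrarily large quotient gaps. There is a Banach space $\mathbb X$ with a Schauder basis $\mathcal B$ that is $\mathbf n$-symmetric for largest coefficients but not democratic.
   Context: Banach spaces $\mathbb X$ are separable and infinite-dimensional over $\mathbb F=\mathbb R$ or $\mathbb C$, with dual $\mathbb X^*$. A basis of $\mathbb X$ is a sequence $\mathcal B=(\mathbf e_i)_{i\in\mathbb N}\subset\mathbb X$ with closed linear span $\mathbb X$, having a (unique) sequence of biorthogonal functionals $(\mathbf e_i^* )_{i\in\mathbb N}\subset\mathbb X^*$ ($\mathbf e_k^*(\mathbf e_i)=\delta_{k,i}$), with $0<\inf_i\min\{\|\mathbf e_i\|,\|\mathbf e_i^*\|\}\le\sup_i\max\{\|\mathbf e_i\|,\|\mathbf e_i^*\|\}<\infty$. It is a Schauder basis if, in addition, $\mathbf e_i^*(x)=0$ for all $i$ implies $x=0$, and there is $\mathbf C>0$ with $\|\sum_{i=1}^m\mathbf e_i^*(x)\mathbf e_i\|\le\mathbf C\|x\|$ for all $x\in\mathbb X$, $m\in\mathbb N$. Put $\operatorname{supp}(x)=\{i:\mathbf e_i^*(x)\ne0\}$. $\mathbf n=(n_k)_{k\in\mathbb N}$ is a strictly increasing sequence of positive integers, also regarded as a subset of $\mathbb N$; it has arbitrarily large quotient gaps if $\limsup_k n_{k+1}/n_k=\infty$. For a finite $A\subset\mathbb N$, $\Psi_A$ is the set of families $\varepsilon=(\varepsilon_n)_{n\in A}\subset\mathbb F$ with $|\varepsilon_n|=1$, $\mathbf 1_{\varepsilon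 A}=\sum_{n\in A}\varepsilon_n\mathbf e_n$ and $\mathbf 1_A=\sum_{n\in A}\mathbf e_n$. $\mathcal B$ is $\mathbf n$-symmetric for largest coefficients if there is $\mathbf C>0$ with $\|x+\mathbf 1_{\varepsilon A}\|\le\mathbf C\|x+\mathbf 1_{\varepsilon'B}\|$ for all $A,B\subset\mathbb N$ with $|A|\le|B|$, $A\cap B=\emptyset$, $|A|,|B|\in\mathbf n$, all $\varepsilon\in\Psi_A$, $\varepsilon'\in\Psi_B$, and all $x\in\mathbb X$ with $|\mathbf e_i^*(x)|\le1$ for all $i$ and $\operatorname{supp}(x)\cap(A\cup B)=\emptyset$. $\mathcal B$ is democratic if there is $\mathbf C>0$ with $\|\mathbf 1_A\|\le\mathbf C\|\mathbf 1_B\|$ for all finite $A,B\subset\mathbb N$ with $|A|\le|B|$. *)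

theory Defs
  imports "HOL-Analysis.Analysis" "HOL-Library.Function_Algebras"
begin

text \<open>
  HOL cannot quantify existentially over types, and the type class of Banach spaces has real scalars
  only. A normed space is therefore given by a carrier \<open>V\<close>, a linear subspace of an ambient vector
  space over the field \<open>'f\<close>, together with a norm \<open>nrm\<close> on \<open>V\<close>. Values of \<open>nrm\<close> and of functionals
  outside \<open>V\<close> are irrelevant.
\<close>

locale normed_carrier = vector_space scale
  for scale :: "'f::real_normed_field \<Rightarrow> 'v::ab_group_add \<Rightarrow> 'v" (infixr \<open>*s\<close> 75) +
  fixes V :: "'v set" and nrm :: "'v \<Rightarrow> real"
  assumes subspace_V: "subspace V"
    and nrm_nonneg: "x \<in> V \<Longrightarrow> 0 \<le> nrm x"
    and nrm_eq_0_iff: "x \<in> V \<Longrightarrow> nrm x = 0 \<longleftrightarrow> x = 0"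
    and nrm_triangle: "x \<in> V \<Longrightarrow> y \<in> V \<Longrightarrow> nrm (x + y) \<le> nrm x + nrm y"
    and nrm_scale: "x \<in> V \<Longrightarrow> nrm (c *s x) = norm c * nrm x"
begin

text \<open>The library requires a distance to be symmetric and nonnegative on the whole type, hence the
  default value off \<open>V\<close>.\<close>

definition ndist :: "'v \<Rightarrow> 'v \<Rightarrow> real"
  where "ndist x y = (if x \<in> V \<and> y \<in> V then nrm (x - y) else 0)"

lemma Metric_space_ndist: "Metric_space V ndist"
proof
  fix x y
  show "0 \<le> ndist x y"
    by (simp add: ndist_def nrm_nonneg subspace_V subspace_diff)
  show "ndist x y = ndist y x"
  proof (cases "x \<in> V \<and> y \<in> V")
    case True
    then have "nrm (y - x) = nrm (- 1 *s (x - y))"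
      by simp
    also have "\<dots> = nrm (x - y)"
      using True nrm_scale[of "x - y" "- 1"] by (simp add: subspace_V subspace_diff)
    finally show ?thesis
      using True by (simp add: ndist_def)
  qed (auto simp: ndist_def)
next
  fix x y assume "x \<in> V" "y \<in> V"
  then show "ndist x y = 0 \<longleftrightarrow> x = y"
    by (simp add: ndist_def nrm_eq_0_iff subspace_V subspace_diff)
next
  fix x y z assume "x \<in> V" "y \<in> V" "z \<in> V"
  then show "ndist x z \<le> ndist x y + ndist y z"
    using nrm_triangle[of "x - y" "y - z"] by (simp add: ndist_def subspace_V subspace_diff)
qed

sublocale metric: Metric_space V ndist
  by (rule Metric_space_ndist)

definition bounded_functional :: "('v \<Rightarrow> 'f) \<Rightarrow> bool"
  where "bounded_functional f \<longleftrightarrow>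
    (\<forall>x\<in>V. \<forall>y\<in>V. f (x + y) = f x + f y) \<and>
    (\<forall>c. \<forall>x\<in>V. f (c *s x) = c * f x) \<and>
    (\<exists>K. \<forall>x\<in>V. norm (f x) \<le> K * nrm x)"

definition dual_norm :: "('v \<Rightarrow> 'f) \<Rightarrow> real"
  where "dual_norm f = (SUP x\<in>{x \<in> V. nrm x \<le> 1}. norm (f x))"

end

locale banach_carrier = normed_carrier +
  assumes complete: "metric.mcomplete"
    and separable: "separable_space metric.mtopology"
    and infinite_dimensional: "\<not> (\<exists>B. finite B \<and> B \<subseteq> V \<and> V \<subseteq> span B)"

text \<open>
  The biorthogonal functionals \<open>es\<close> are part of the data; on \<open>V\<close> they are determined by \<open>e\<close>, since
  the span of \<open>e\<close> is dense. Indices start at 0.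
\<close>

locale banach_basis = banach_carrier scale V nrm
  for scale :: "'f::real_normed_field \<Rightarrow> 'v::ab_group_add \<Rightarrow> 'v" (infixr \<open>*s\<close> 75)
    and V :: "'v set" and nrm :: "'v \<Rightarrow> real" +
  fixes e :: "nat \<Rightarrow> 'v" and es :: "nat \<Rightarrow> 'v \<Rightarrow> 'f"
  assumes e_in_V: "e i \<in> V"
    and es_bounded: "bounded_functional (es i)"
    and dense_span: "metric.mtopology closure_of (span (range e)) = V"
    and biorthogonal: "es k (e i) = (if k = i then 1 else 0)"
    and seminormalized_below: "0 < (INF i. min (nrm (e i)) (dual_norm (es i)))"
    and seminormalized_above: "bdd_above (range (\<lambda>i. max (nrm (e i)) (dual_norm (es i))))"

locale schauder_basis = banach_basis +
  assumes total: "x \<in> V \<Longrightarrow> (\<And>i. es i x = 0) \<Longrightarrow> x = 0"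
    and partial_sums_bounded:
      "\<exists>C>0. \<forall>x\<in>V. \<forall>m. nrm (\<Sum>i\<le>m. es i x *s e i) \<le> C * nrm x"

definition supp :: "(nat \<Rightarrow> 'v \<Rightarrow> 'f::zero) \<Rightarrow> 'v \<Rightarrow> nat set"
  where "supp es x = {i. es i x \<noteq> 0}"

text \<open>Only the values on \<open>A\<close> matter.\<close>

definition signs :: "nat set \<Rightarrow> (nat \<Rightarrow> 'f::real_normed_field) set"
  where "signs A = {\<epsilon>. \<forall>i\<in>A. norm (\<epsilon> i) = 1}"

definition signed_indicator ::
    "('f \<Rightarrow> 'v \<Rightarrow> 'v) \<Rightarrow> (nat \<Rightarrow> 'v) \<Rightarrow> (nat \<Rightarrow> 'f) \<Rightarrow> nat set \<Rightarrow> 'v::ab_group_add"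
  where "signed_indicator smul e \<epsilon> A = (\<Sum>i\<in>A. smul (\<epsilon> i) (e i))"

definition arbitrarily_large_quotient_gaps :: "(nat \<Rightarrow> nat) \<Rightarrow> bool"
  where "arbitrarily_large_quotient_gaps n \<longleftrightarrow>
    limsup (\<lambda>k. ereal (real (n (Suc k)) / real (n k))) = \<infinity>"

definition symmetric_for_largest_coefficients ::
    "(nat \<Rightarrow> nat) \<Rightarrow> ('f::real_normed_field \<Rightarrow> 'v::ab_group_add \<Rightarrow> 'v) \<Rightarrow> 'v set \<Rightarrow>
     ('v \<Rightarrow> real) \<Rightarrow> (nat \<Rightarrow> 'v) \<Rightarrow> (nat \<Rightarrow> 'v \<Rightarrow> 'f) \<Rightarrow> bool"
  where "symmetric_for_largest_coefficients n smul V nrm e es \<longleftrightarrow>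
    (\<exists>C>0. \<forall>A B. finite A \<and> finite B \<and> card A \<le> card B \<and> A \<inter> B = {} \<and>
        card A \<in> range n \<and> card B \<in> range n \<longrightarrow>
      (\<forall>\<epsilon>\<in>signs A. \<forall>\<epsilon>'\<in>signs B. \<forall>x\<in>V.
        (\<forall>i. norm (es i x) \<le> 1) \<and> supp es x \<inter> (A \<union> B) = {} \<longrightarrow>
        nrm (x + signed_indicator smul e \<epsilon> A) \<le> C * nrm (x + signed_indicator smul e \<epsilon>' B)))"

definition democratic :: "('v::ab_group_add \<Rightarrow> real) \<Rightarrow> (nat \<Rightarrow> 'v) \<Rightarrow> bool"
  where "democratic nrm e \<longleftrightarrow>
    (\<exists>C>0. \<forall>A B. finite A \<and> finite B \<and> card A \<le> card B \<longrightarrow>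
      nrm (\<Sum>i\<in>A. e i) \<le> C * nrm (\<Sum>i\<in>B. e i))"

text \<open>
  The ambient space of all scalar sequences: every separable Banach space is isomorphic, as a vector
  space, to a subspace of it, so existence of a Banach space may be stated as existence of such a
  carrier with a norm.
\<close>

definition seq_scale :: "'f::field \<Rightarrow> (nat \<Rightarrow> 'f) \<Rightarrow> nat \<Rightarrow> 'f"
  where "seq_scale c x = (\<lambda>i. c * x i)"

end

theory Submission
  imports Defs
begin

text \<open>
  A norm of the form \<open>x \<mapsto> sup (\<Sum>i\<in>A. \<bar>x i\<bar>) / d\<close>, the supremum running over a prescribed family of
  pairs \<open>(A, d)\<close> of a finite set and a weight \<open>d \<ge> 1\<close>, depends monotonically on the moduli of the
  coordinates. On the sequences whose tails tend to \<open>0\<close> in this norm, the unit vectors are therefore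
  a 1-unconditional basis (\<open>schauder_basis_gauge\<close>).

  For a 1-unconditional basis, symmetry for largest coefficients reduces to a comparison of the norms
  of \<open>1\<^bsub>\<epsilon>A\<^esub>\<close> and \<open>1\<^bsub>\<epsilon>'B\<^esub>\<close>: if \<open>x\<close> is supported off \<open>A \<union> B\<close>, then both \<open>x\<close> and \<open>1\<^bsub>\<epsilon>'B\<^esub>\<close> are dominated
  coordinatewise by \<open>x + 1\<^bsub>\<epsilon>'B\<^esub>\<close>, and the triangle inequality gives the constant \<open>2\<close>. So it suffices
  to find a family for which the norm of \<open>1\<^bsub>\<epsilon>A\<^esub>\<close> depends only on \<open>\<bar>A\<bar>\<close> when \<open>\<bar>A\<bar>\<close> is a term of the sequence,
  but for which this fails badly at some other cardinalities.

  The pairs \<open>(A, \<surd>\<bar>A\<bar>)\<close> for all finite nonempty \<open>A\<close> give the weak-\<open>l\<^sup>2\<close> norm, in which \<open>1\<^bsub>\<epsilon>A\<^esub>\<close> has norm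
  \<open>\<surd>\<bar>A\<bar>\<close>. Whenever \<open>q\<^sup>4 n\<^sub>k \<le> n\<^bsub>k+1\<^esub>\<close>, a set \<open>S\<close> of \<open>q\<^sup>2 n\<^sub>k\<close> even numbers is added with the small weight
  \<open>\<surd>n\<^sub>k\<close>. The size of \<open>S\<close> is the geometric mean of \<open>n\<^sub>k\<close> and \<open>q\<^sup>4 n\<^sub>k\<close>, and this hides \<open>S\<close> from
  sets whose size is a term of the sequence: the new quotient for \<open>1\<^sub>A\<close> is
  at most \<open>\<bar>A\<bar> / \<surd>n\<^sub>k \<le> \<surd>\<bar>A\<bar>\<close> if \<open>\<bar>A\<bar> \<le> n\<^sub>k\<close>, and at most \<open>\<bar>S\<bar> / \<surd>n\<^sub>k = q\<^sup>2 \<surd>n\<^sub>k \<le> \<surd>\<bar>A\<bar>\<close> if \<open>\<bar>A\<bar> \<ge> n\<^bsub>k+1\<^esub>\<close>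
  (\<open>card_Int_le_gap_family\<close>). But \<open>1\<^sub>S\<close> itself has norm at least \<open>q\<^sup>2 \<surd>n\<^sub>k\<close>, while equally many odd
  numbers, which meet none of the added sets, give norm only \<open>q \<surd>n\<^sub>k\<close>. Large quotient gaps make
  arbitrarily large \<open>q\<close> available, so the basis is not democratic.
\<close>

section \<open>Norms generated by weighted finite sets\<close>

locale gauge_family =
  fixes F :: "(nat set \<times> real) set"
  assumes finite_set: "(A, d) \<in> F \<Longrightarrow> finite A"
    and weight_ge_1: "(A, d) \<in> F \<Longrightarrow> 1 \<le> d"
    and singleton: "({i}, 1) \<in> F"
begin

definition gauge_norm :: "(nat \<Rightarrow> 'f::real_normed_vector) \<Rightarrow> real"
  where "gauge_norm x = (SUP (A, d)\<in>F. (\<Sum>i\<in>A. norm (x i)) / d)"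

text \<open>
  The pairs need not give a bounded supremum on all sequences, and where they do, finitely supported
  sequences need not be dense. The carrier is therefore the closure of the finitely supported ones,
  written without mention of the supremum: the truncation error is at most \<open>\<epsilon>\<close>.
\<close>

definition vanishing_tails :: "(nat \<Rightarrow> 'f::real_normed_vector) set"
  where "vanishing_tails =
    {x. \<forall>\<epsilon>>0. \<exists>m. \<forall>A d. (A, d) \<in> F \<longrightarrow> (\<Sum>i\<in>A - {..<m}. norm (x i)) \<le> \<epsilon> * d}"

lemma vanishing_tailsD:
  assumes "x \<in> vanishing_tails" "0 < \<epsilon>"
  obtains m where "\<And>A d. (A, d) \<in> F \<Longrightarrow> (\<Sum>i\<in>A - {..<m}. norm (x i)) \<le> \<epsilon> * d"
  using assms unfolding vanishing_tails_def by blast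

lemma vanishing_tailsI:
  assumes "\<And>\<epsilon>. 0 < \<epsilon> \<Longrightarrow> \<exists>m. \<forall>A d. (A, d) \<in> F \<longrightarrow> (\<Sum>i\<in>A - {..<m}. norm (x i)) \<le> \<epsilon> * d"
  shows "x \<in> vanishing_tails"
  using assms unfolding vanishing_tails_def by blast

text \<open>
  Since all weights are at least \<open>1\<close>, the first \<open>m\<close> coordinates contribute at most their \<open>l\<^sup>1\<close> norm. This
  turns control of the tails into boundedness, and coordinatewise approximation into approximation
  in norm.
\<close>

lemma sum_split_le:
  assumes "(A, d) \<in> F"
  shows "(\<Sum>i\<in>A. norm (x i)) \<le> (\<Sum>i<m. norm (x i)) * d + (\<Sum>i\<in>A - {..<m}. norm (x i))"
proof -
  have fin: "finite A" and d: "1 \<le> d"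
    using assms finite_set weight_ge_1 by blast+
  have "(\<Sum>i\<in>A. norm (x i)) = (\<Sum>i\<in>A \<inter> {..<m}. norm (x i)) + (\<Sum>i\<in>A - {..<m}. norm (x i))"
    by (rule sum.Int_Diff[OF fin])
  moreover have "(\<Sum>i\<in>A \<inter> {..<m}. norm (x i)) \<le> (\<Sum>i<m. norm (x i))"
    by (rule sum_mono2) auto
  moreover have "(\<Sum>i<m. norm (x i)) * 1 \<le> (\<Sum>i<m. norm (x i)) * d"
    using d by (intro mult_left_mono sum_nonneg) auto
  ultimately show ?thesis
    by simp
qed

lemma bdd_above_gauge:
  assumes "x \<in> vanishing_tails"
  shows "bdd_above ((\<lambda>(A, d). (\<Sum>i\<in>A. norm (x i)) / d) ` F)"
proof -
  obtain m where m: "\<And>A d. (A, d) \<in> F \<Longrightarrow> (\<Sum>i\<in>A - {..<m}. norm (x i)) \<le> 1 * d"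
    using vanishing_tailsD[OF assms zero_less_one] by blast
  have "(\<Sum>i\<in>A. norm (x i)) / d \<le> (\<Sum>i<m. norm (x i)) + 1" if "(A, d) \<in> F" for A d
  proof -
    have "(\<Sum>i\<in>A. norm (x i)) \<le> ((\<Sum>i<m. norm (x i)) + 1) * d"
      using sum_split_le[OF that, of x m] m[OF that] by (simp add: distrib_right)
    then show ?thesis
      using weight_ge_1[OF that] by (simp add: divide_le_eq)
  qed
  then show ?thesis
    by (intro bdd_aboveI[of _ "(\<Sum>i<m. norm (x i)) + 1"]) auto
qed

lemma sum_le_gauge_norm:
  assumes "x \<in> vanishing_tails" "(A, d) \<in> F"
  shows "(\<Sum>i\<in>A. norm (x i)) \<le> gauge_norm x * d"
proof -
  have "(\<Sum>i\<in>A. norm (x i)) / d \<le> gauge_norm x"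
    using cSUP_upper[OF assms(2) bdd_above_gauge[OF assms(1)]] by (simp add: gauge_norm_def)
  then show ?thesis
    using weight_ge_1[OF assms(2)] by (simp add: divide_le_eq)
qed

lemma gauge_norm_le:
  assumes "\<And>A d. (A, d) \<in> F \<Longrightarrow> (\<Sum>i\<in>A. norm (x i)) \<le> c * d"
  shows "gauge_norm x \<le> c"
  unfolding gauge_norm_def
proof (rule cSUP_least)
  show "F \<noteq> {}"
    using singleton by auto
  fix p assume "p \<in> F"
  moreover obtain A d where "p = (A, d)"
    by fastforce
  ultimately show "(case p of (A, d) \<Rightarrow> (\<Sum>i\<in>A. norm (x i)) / d) \<le> c"
    using assms[of A d] weight_ge_1[of A d] by (simp add: divide_le_eq)
qed

lemma norm_le_gauge_norm: "x \<in> vanishing_tails \<Longrightarrow> norm (x i) \<le> gauge_norm x"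
  using sum_le_gauge_norm[OF _ singleton[of i]] by simp

lemma gauge_norm_nonneg: "x \<in> vanishing_tails \<Longrightarrow> 0 \<le> gauge_norm x"
  using norm_le_gauge_norm[of x 0] norm_ge_zero[of "x 0"] by linarith

lemma gauge_norm_mono:
  assumes "y \<in> vanishing_tails" "\<And>i. norm (x i) \<le> norm (y i)"
  shows "gauge_norm x \<le> gauge_norm y"
proof (rule gauge_norm_le)
  fix A d assume "(A, d) \<in> F"
  then show "(\<Sum>i\<in>A. norm (x i)) \<le> gauge_norm y * d"
    using sum_le_gauge_norm[OF assms(1)] sum_mono[of A "\<lambda>i. norm (x i)" "\<lambda>i. norm (y i)"] assms(2)
    by fastforce
qed

lemma finite_support_vanishing_tails:
  assumes "\<And>i. m \<le> i \<Longrightarrow> x i = 0"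
  shows "x \<in> vanishing_tails"
proof (rule vanishing_tailsI)
  fix \<epsilon> :: real assume "0 < \<epsilon>"
  have "(\<Sum>i\<in>A - {..<m}. norm (x i)) \<le> \<epsilon> * d" if "(A, d) \<in> F" for A d
  proof -
    have "(\<Sum>i\<in>A - {..<m}. norm (x i)) = 0"
      using assms by (intro sum.neutral) auto
    then show ?thesis
      using weight_ge_1[OF that] \<open>0 < \<epsilon>\<close> by simp
  qed
  then show "\<exists>m. \<forall>A d. (A, d) \<in> F \<longrightarrow> (\<Sum>i\<in>A - {..<m}. norm (x i)) \<le> \<epsilon> * d"
    by blast
qed

lemma vanishing_tails_add:
  assumes "x \<in> vanishing_tails" "y \<in> vanishing_tails"
  shows "x + y \<in> vanishing_tails"
proof (rule vanishing_tailsI)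
  fix \<epsilon> :: real assume "0 < \<epsilon>"
  then have half: "0 < \<epsilon> / 2"
    by simp
  obtain m where m: "\<And>A d. (A, d) \<in> F \<Longrightarrow> (\<Sum>i\<in>A - {..<m}. norm (x i)) \<le> \<epsilon> / 2 * d"
    using vanishing_tailsD[OF assms(1) half] by blast
  obtain m' where m': "\<And>A d. (A, d) \<in> F \<Longrightarrow> (\<Sum>i\<in>A - {..<m'}. norm (y i)) \<le> \<epsilon> / 2 * d"
    using vanishing_tailsD[OF assms(2) half] by blast
  have "(\<Sum>i\<in>A - {..<max m m'}. norm ((x + y) i)) \<le> \<epsilon> * d" if F: "(A, d) \<in> F" for A d
  proof -
    have fin: "finite A"
      using finite_set[OF F] .
    have "(\<Sum>i\<in>A - {..<max m m'}. norm ((x + y) i))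
        \<le> (\<Sum>i\<in>A - {..<max m m'}. norm (x i)) + (\<Sum>i\<in>A - {..<max m m'}. norm (y i))"
      by (simp add: sum.distrib[symmetric] sum_mono norm_triangle_ineq)
    also have "\<dots> \<le> (\<Sum>i\<in>A - {..<m}. norm (x i)) + (\<Sum>i\<in>A - {..<m'}. norm (y i))"
      using fin by (intro add_mono sum_mono2) auto
    also have "\<dots> \<le> \<epsilon> / 2 * d + \<epsilon> / 2 * d"
      by (intro add_mono m[OF F] m'[OF F])
    finally show ?thesis
      by simp
  qed
  then show "\<exists>m. \<forall>A d. (A, d) \<in> F \<longrightarrow> (\<Sum>i\<in>A - {..<m}. norm ((x + y) i)) \<le> \<epsilon> * d"
    by blast
qed

lemma vanishing_tails_scale:
  fixes c :: "'f::real_normed_field"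
  assumes "x \<in> vanishing_tails"
  shows "seq_scale c x \<in> vanishing_tails"
proof (rule vanishing_tailsI)
  fix \<epsilon> :: real assume "0 < \<epsilon>"
  then have "0 < \<epsilon> / (norm c + 1)"
    by (simp add: add_nonneg_pos)
  then obtain m where
    m: "\<And>A d. (A, d) \<in> F \<Longrightarrow> (\<Sum>i\<in>A - {..<m}. norm (x i)) \<le> \<epsilon> / (norm c + 1) * d"
    using vanishing_tailsD[OF assms] by blast
  have "(\<Sum>i\<in>A - {..<m}. norm (seq_scale c x i)) \<le> \<epsilon> * d" if "(A, d) \<in> F" for A d
  proof -
    have "(\<Sum>i\<in>A - {..<m}. norm (seq_scale c x i)) = norm c * (\<Sum>i\<in>A - {..<m}. norm (x i))"
      by (simp add: seq_scale_def norm_mult sum_distrib_left)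
    also have "\<dots> \<le> (norm c + 1) * (\<epsilon> / (norm c + 1) * d)"
      using m[OF that] by (intro mult_mono sum_nonneg) auto
    also have "\<dots> = \<epsilon> * d"
      using add_nonneg_pos[OF norm_ge_zero[of c] zero_less_one] by simp
    finally show ?thesis .
  qed
  then show "\<exists>m. \<forall>A d. (A, d) \<in> F \<longrightarrow> (\<Sum>i\<in>A - {..<m}. norm (seq_scale c x i)) \<le> \<epsilon> * d"
    by blast
qed

lemma gauge_norm_triangle:
  assumes "x \<in> vanishing_tails" "y \<in> vanishing_tails"
  shows "gauge_norm (x + y) \<le> gauge_norm x + gauge_norm y"
proof (rule gauge_norm_le)
  fix A d assume F: "(A, d) \<in> F"
  have "(\<Sum>i\<in>A. norm ((x + y) i)) \<le> (\<Sum>i\<in>A. norm (x i)) + (\<Sum>i\<in>A. norm (y i))"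
    by (simp add: sum.distrib[symmetric] sum_mono norm_triangle_ineq)
  then show "(\<Sum>i\<in>A. norm ((x + y) i)) \<le> (gauge_norm x + gauge_norm y) * d"
    using sum_le_gauge_norm[OF assms(1) F] sum_le_gauge_norm[OF assms(2) F]
    by (simp add: distrib_right)
qed

lemma gauge_norm_scale_le:
  fixes c :: "'f::real_normed_field"
  assumes "x \<in> vanishing_tails"
  shows "gauge_norm (seq_scale c x) \<le> norm c * gauge_norm x"
proof (rule gauge_norm_le)
  fix A d assume F: "(A, d) \<in> F"
  have "(\<Sum>i\<in>A. norm (seq_scale c x i)) = norm c * (\<Sum>i\<in>A. norm (x i))"
    by (simp add: seq_scale_def norm_mult sum_distrib_left)
  also have "\<dots> \<le> norm c * (gauge_norm x * d)"
    by (intro mult_left_mono sum_le_gauge_norm[OF assms F]) simp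
  finally show "(\<Sum>i\<in>A. norm (seq_scale c x i)) \<le> norm c * gauge_norm x * d"
    by (simp add: mult.assoc)
qed

lemma gauge_norm_scale:
  fixes c :: "'f::real_normed_field"
  assumes x: "x \<in> vanishing_tails"
  shows "gauge_norm (seq_scale c x) = norm c * gauge_norm x"
proof (cases "c = 0")
  case True
  have "0 \<le> gauge_norm (seq_scale c x)"
    by (rule gauge_norm_nonneg[OF vanishing_tails_scale[OF x]])
  then show ?thesis
    using True gauge_norm_scale_le[OF x, of c] by simp
next
  case False
  have "gauge_norm x = gauge_norm (seq_scale (inverse c) (seq_scale c x))"
    using False by (simp add: seq_scale_def mult.assoc[symmetric])
  also have "\<dots> \<le> norm (inverse c) * gauge_norm (seq_scale c x)"
    by (rule gauge_norm_scale_le[OF vanishing_tails_scale[OF x]])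
  also have "\<dots> = gauge_norm (seq_scale c x) / norm c"
    by (simp add: norm_inverse divide_real_def mult.commute)
  finally have "norm c * gauge_norm x \<le> gauge_norm (seq_scale c x)"
    using False by (simp add: pos_le_divide_eq mult.commute)
  then show ?thesis
    using gauge_norm_scale_le[OF x, of c] by simp
qed

end

section \<open>The unit vectors as a Schauder basis\<close>

lemma vector_space_seq_scale: "vector_space (seq_scale :: 'f::field \<Rightarrow> _)"
  by unfold_locales (auto simp: seq_scale_def algebra_simps)

definition unit_seq :: "nat \<Rightarrow> nat \<Rightarrow> 'f::zero_neq_one"
  where "unit_seq i = (\<lambda>j. if j = i then 1 else 0)"

lemma inj_unit_seq: "inj (unit_seq :: nat \<Rightarrow> nat \<Rightarrow> 'a::zero_neq_one)"
  by (rule injI) (metis unit_seq_def zero_neq_one)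

lemma unit_seq_apply: "unit_seq i j = (if j = i then 1 else 0)"
  by (simp add: unit_seq_def)

lemma sum_seq_apply: "(\<Sum>i\<in>A. g i) j = (\<Sum>i\<in>A. g i j)"
  for g :: "'a \<Rightarrow> nat \<Rightarrow> 'b::comm_monoid_add"
  by (induction A rule: infinite_finite_induct) auto

lemma sum_scale_unit_seq_apply:
  assumes "finite A"
  shows "(\<Sum>i\<in>A. seq_scale (c i) (unit_seq i)) j = (if j \<in> A then c j else 0)"
proof -
  have "(\<Sum>i\<in>A. seq_scale (c i) (unit_seq i)) j = (\<Sum>i\<in>A. if j = i then c i else 0)"
    unfolding sum_seq_apply by (intro sum.cong) (auto simp: seq_scale_def unit_seq_def)
  then show ?thesis
    using assms by (simp add: sum.delta')
qed

context gauge_family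
begin

lemma unit_seq_vanishing_tails: "unit_seq i \<in> vanishing_tails"
  by (rule finite_support_vanishing_tails[of "Suc i"]) (auto simp: unit_seq_def)

lemma gauge_norm_unit_seq: "gauge_norm (unit_seq i :: nat \<Rightarrow> 'f::real_normed_field) = 1"
proof (rule antisym)
  show "1 \<le> gauge_norm (unit_seq i :: nat \<Rightarrow> 'f)"
    using norm_le_gauge_norm[of "unit_seq i :: nat \<Rightarrow> 'f" i] unit_seq_vanishing_tails[of i]
    by (simp add: unit_seq_def)
  show "gauge_norm (unit_seq i :: nat \<Rightarrow> 'f) \<le> 1"
  proof (rule gauge_norm_le)
    fix A d assume F: "(A, d) \<in> F"
    have "(\<Sum>j\<in>A. norm (unit_seq i j :: 'f)) = (\<Sum>j\<in>A. if j = i then 1 else 0)"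
      by (intro sum.cong) (auto simp: unit_seq_def)
    also have "\<dots> \<le> 1 * d"
      using finite_set[OF F] weight_ge_1[OF F] by (simp add: sum.delta)
    finally show "(\<Sum>j\<in>A. norm (unit_seq i j :: 'f)) \<le> 1 * d" .
  qed
qed

lemma normed_carrier_gauge:
  "normed_carrier (seq_scale :: 'f::real_normed_field \<Rightarrow> _) vanishing_tails gauge_norm"
proof -
  interpret vector_space "seq_scale :: 'f \<Rightarrow> _"
    by (rule vector_space_seq_scale)
  show ?thesis
  proof
    show "subspace (vanishing_tails :: (nat \<Rightarrow> 'f) set)"
      by (intro subspaceI vanishing_tails_add vanishing_tails_scale)
        (auto intro: finite_support_vanishing_tails)
    fix x :: "nat \<Rightarrow> 'f" assume x: "x \<in> vanishing_tails"
    show "0 \<le> gauge_norm x"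
      by (rule gauge_norm_nonneg[OF x])
    show "gauge_norm x = 0 \<longleftrightarrow> x = 0"
    proof
      assume "gauge_norm x = 0"
      then show "x = 0"
        using norm_le_gauge_norm[OF x] by (intro ext) simp
    next
      assume "x = 0"
      then have "gauge_norm x \<le> 0"
        by (intro gauge_norm_le) simp
      then show "gauge_norm x = 0"
        using gauge_norm_nonneg[OF x] by simp
    qed
    show "gauge_norm (seq_scale c x) = norm c * gauge_norm x" for c
      by (rule gauge_norm_scale[OF x])
    show "gauge_norm (x + y) \<le> gauge_norm x + gauge_norm y" if "y \<in> vanishing_tails" for y
      by (rule gauge_norm_triangle[OF x that])
  qed
qed

lemma vanishing_tails_diff:
  fixes x y :: "nat \<Rightarrow> 'f::real_normed_field"
  assumes "x \<in> vanishing_tails" "y \<in> vanishing_tails"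
  shows "x - y \<in> vanishing_tails"
proof -
  have "x + seq_scale (- 1) y \<in> vanishing_tails"
    by (intro vanishing_tails_add vanishing_tails_scale assms)
  moreover have "x + seq_scale (- 1) y = x - y"
    by (auto simp: seq_scale_def)
  ultimately show ?thesis
    by simp
qed

text \<open>
  The singletons make the coordinates norm-continuous, so a Cauchy sequence converges coordinatewise.
  The estimates for finite sums survive the limit uniformly over the family, which gives convergence
  in norm as well as the smallness of the tails of the limit.
\<close>

lemma gauge_norm_complete:
  fixes \<sigma> :: "nat \<Rightarrow> nat \<Rightarrow> 'f::{real_normed_field, banach}"
  assumes \<sigma>: "\<And>n. \<sigma> n \<in> vanishing_tails"
    and Cauchy: "\<And>\<epsilon>. 0 < \<epsilon> \<Longrightarrow> \<exists>N. \<forall>n\<ge>N. \<forall>n'\<ge>N. gauge_norm (\<sigma> n - \<sigma> n') < \<epsilon>"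
  shows "\<exists>x\<in>vanishing_tails. \<forall>\<epsilon>>0. \<exists>N. \<forall>n\<ge>N. gauge_norm (\<sigma> n - x) < \<epsilon>"
proof -
  have diff: "\<sigma> n - \<sigma> n' \<in> vanishing_tails" for n n'
    by (intro vanishing_tails_diff \<sigma>)
  have "Cauchy (\<lambda>n. \<sigma> n i)" for i
  proof (rule metric_CauchyI)
    fix \<epsilon> :: real assume "0 < \<epsilon>"
    then obtain N where N: "\<And>n n'. N \<le> n \<Longrightarrow> N \<le> n' \<Longrightarrow> gauge_norm (\<sigma> n - \<sigma> n') < \<epsilon>"
      using Cauchy by blast
    have "dist (\<sigma> n i) (\<sigma> n' i) < \<epsilon>" if "N \<le> n" "N \<le> n'" for n n'
      using N[OF that] norm_le_gauge_norm[OF diff, of n n' i] by (simp add: dist_norm)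
    then show "\<exists>N. \<forall>m\<ge>N. \<forall>n\<ge>N. dist (\<sigma> m i) (\<sigma> n i) < \<epsilon>"
      by blast
  qed
  then have "\<exists>l. (\<lambda>n. \<sigma> n i) \<longlonglongrightarrow> l" for i
    using Cauchy_convergent_iff convergent_def by blast
  then obtain x where x: "\<And>i. (\<lambda>n. \<sigma> n i) \<longlonglongrightarrow> x i"
    by metis
  \<comment> \<open>Each finite sum passes to the coordinatewise limit, with the same bound for all members
    of the family.\<close>
  have unif: "\<exists>N. \<forall>n\<ge>N. \<forall>A d. (A, d) \<in> F \<longrightarrow> (\<Sum>i\<in>A. norm ((\<sigma> n - x) i)) \<le> \<epsilon> * d"
    if pos: "0 < \<epsilon>" for \<epsilon> :: real
  proof -
    obtain N where N: "\<And>n n'. N \<le> n \<Longrightarrow> N \<le> n' \<Longrightarrow> gauge_norm (\<sigma> n - \<sigma> n') < \<epsilon>"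
      using Cauchy[OF pos] by blast
    have "(\<Sum>i\<in>A. norm ((\<sigma> n - x) i)) \<le> \<epsilon> * d" if n: "N \<le> n" and F: "(A, d) \<in> F" for n A d
    proof (rule LIMSEQ_le_const2)
      show "(\<lambda>n'. \<Sum>i\<in>A. norm ((\<sigma> n - \<sigma> n') i)) \<longlonglongrightarrow> (\<Sum>i\<in>A. norm ((\<sigma> n - x) i))"
        by (auto intro!: tendsto_intros x)
      have "(\<Sum>i\<in>A. norm ((\<sigma> n - \<sigma> n') i)) \<le> \<epsilon> * d" if n': "N \<le> n'" for n'
      proof -
        have "(\<Sum>i\<in>A. norm ((\<sigma> n - \<sigma> n') i)) \<le> gauge_norm (\<sigma> n - \<sigma> n') * d"
          by (rule sum_le_gauge_norm[OF diff F])
        also have "\<dots> \<le> \<epsilon> * d"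
          using N[OF n n'] weight_ge_1[OF F] by (intro mult_right_mono) auto
        finally show ?thesis .
      qed
      then show "\<exists>N. \<forall>n'\<ge>N. (\<Sum>i\<in>A. norm ((\<sigma> n - \<sigma> n') i)) \<le> \<epsilon> * d"
        by blast
    qed
    then show ?thesis
      by blast
  qed
  have "x \<in> vanishing_tails"
  proof (rule vanishing_tailsI)
    fix \<epsilon> :: real assume "0 < \<epsilon>"
    then have half: "0 < \<epsilon> / 2"
      by simp
    obtain n where n: "\<And>A d. (A, d) \<in> F \<Longrightarrow> (\<Sum>i\<in>A. norm ((\<sigma> n - x) i)) \<le> \<epsilon> / 2 * d"
      using unif[OF half] by blast
    obtain m where m: "\<And>A d. (A, d) \<in> F \<Longrightarrow> (\<Sum>i\<in>A - {..<m}. norm (\<sigma> n i)) \<le> \<epsilon> / 2 * d"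
      using vanishing_tailsD[OF \<sigma> half] by blast
    have "(\<Sum>i\<in>A - {..<m}. norm (x i)) \<le> \<epsilon> * d" if F: "(A, d) \<in> F" for A d
    proof -
      have "(\<Sum>i\<in>A - {..<m}. norm (x i))
          \<le> (\<Sum>i\<in>A - {..<m}. norm (\<sigma> n i) + norm ((\<sigma> n - x) i))"
        by (intro sum_mono) (metis minus_apply norm_minus_commute norm_triangle_sub)
      also have "\<dots> \<le> (\<Sum>i\<in>A - {..<m}. norm (\<sigma> n i)) + (\<Sum>i\<in>A. norm ((\<sigma> n - x) i))"
        unfolding sum.distrib using finite_set[OF F] by (intro add_mono sum_mono2) auto
      also have "\<dots> \<le> \<epsilon> / 2 * d + \<epsilon> / 2 * d"
        by (intro add_mono m[OF F] n[OF F])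
      finally show ?thesis
        by simp
    qed
    then show "\<exists>m. \<forall>A d. (A, d) \<in> F \<longrightarrow> (\<Sum>i\<in>A - {..<m}. norm (x i)) \<le> \<epsilon> * d"
      by blast
  qed
  moreover have "\<exists>N. \<forall>n\<ge>N. gauge_norm (\<sigma> n - x) < \<epsilon>" if "0 < \<epsilon>" for \<epsilon>
  proof -
    have half: "0 < \<epsilon> / 2"
      using that by simp
    obtain N where
      N: "\<And>n A d. N \<le> n \<Longrightarrow> (A, d) \<in> F \<Longrightarrow> (\<Sum>i\<in>A. norm ((\<sigma> n - x) i)) \<le> \<epsilon> / 2 * d"
      using unif[OF half] by blast
    have "gauge_norm (\<sigma> n - x) \<le> \<epsilon> / 2" if "N \<le> n" for n
      by (rule gauge_norm_le[OF N[OF that]])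
    then show ?thesis
      using half by (metis field_sum_of_halves less_add_same_cancel1 order.strict_trans1)
  qed
  ultimately show ?thesis
    by blast
qed

text \<open>
  Up to a small error in norm, \<open>x\<close> has only finitely many nonzero coordinates, and these can be moved
  into \<open>D\<close> one by one. Used with a countable dense set of scalars, this gives separability and the density of the span of
  the unit vectors at once.
\<close>

lemma gauge_norm_dense:
  fixes x :: "nat \<Rightarrow> 'f::real_normed_field"
  assumes x: "x \<in> vanishing_tails" and "0 < \<epsilon>"
    and D: "\<And>a \<delta>. 0 < \<delta> \<Longrightarrow> \<exists>b\<in>D. dist b a < \<delta>"
  shows "\<exists>m y. (\<forall>i<m. y i \<in> D) \<and> (\<forall>i\<ge>m. y i = 0) \<and> gauge_norm (x - y) < \<epsilon>"
proof -
  define \<delta> where "\<delta> = \<epsilon> / 4"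
  have \<delta>: "0 < \<delta>"
    using \<open>0 < \<epsilon>\<close> by (simp add: \<delta>_def)
  obtain m where m: "\<And>A d. (A, d) \<in> F \<Longrightarrow> (\<Sum>i\<in>A - {..<m}. norm (x i)) \<le> \<delta> * d"
    using vanishing_tailsD[OF x \<delta>] by blast
  have "\<exists>b\<in>D. dist b (x i) < \<delta> / (m + 1)" for i
    using \<delta> by (intro D) simp
  then obtain b where b: "\<And>i. b i \<in> D" "\<And>i. dist (b i) (x i) < \<delta> / (m + 1)"
    by metis
  define y where "y = (\<lambda>i. if i < m then b i else 0)"
  have "gauge_norm (x - y) \<le> \<delta> + \<delta>"
  proof (rule gauge_norm_le)
    fix A d assume F: "(A, d) \<in> F"
    have "(\<Sum>i<m. norm ((x - y) i)) \<le> (\<Sum>i<m. \<delta> / (m + 1))"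
      using b(2) by (intro sum_mono) (auto simp: y_def dist_norm norm_minus_commute less_imp_le)
    also have "\<dots> \<le> \<delta>"
      using \<delta> by (simp add: field_simps)
    finally have "(\<Sum>i<m. norm ((x - y) i)) * d \<le> \<delta> * d"
      using weight_ge_1[OF F] by (intro mult_right_mono) auto
    moreover have "(\<Sum>i\<in>A - {..<m}. norm ((x - y) i)) = (\<Sum>i\<in>A - {..<m}. norm (x i))"
      by (intro sum.cong) (auto simp: y_def)
    ultimately show "(\<Sum>i\<in>A. norm ((x - y) i)) \<le> (\<delta> + \<delta>) * d"
      using sum_split_le[OF F, of "x - y" m] m[OF F] by (simp add: distrib_right)
  qed
  then have "gauge_norm (x - y) < \<epsilon>"
    using \<open>0 < \<epsilon>\<close> by (simp add: \<delta>_def)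
  then show ?thesis
    using b(1) by (intro exI[of _ m] exI[of _ y]) (auto simp: y_def)
qed

theorem schauder_basis_gauge:
  "schauder_basis (seq_scale :: 'f::{real_normed_field, banach, second_countable_topology} \<Rightarrow> _)
    vanishing_tails gauge_norm unit_seq (\<lambda>i x. x i)"
proof -
  let ?V = "vanishing_tails :: (nat \<Rightarrow> 'f) set"
  interpret N: normed_carrier "seq_scale :: 'f \<Rightarrow> _" ?V gauge_norm
    by (rule normed_carrier_gauge)
  obtain D :: "'f set" where "countable D"
    and D: "\<And>U. open U \<Longrightarrow> U \<noteq> {} \<Longrightarrow> \<exists>b\<in>D. b \<in> U"
    using countable_dense_exists by blast
  have D: "\<exists>b\<in>D. dist b a < \<delta>" if "0 < \<delta>" for a \<delta>
    using D[of "ball a \<delta>"] that by (auto simp: dist_commute)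
  define C where "C = {y :: nat \<Rightarrow> 'f. \<exists>m. (\<forall>i<m. y i \<in> D) \<and> (\<forall>i\<ge>m. y i = 0)}"
  have C_V: "C \<subseteq> ?V"
    by (auto simp: C_def intro: finite_support_vanishing_tails)
  have C_dense: "N.metric.mtopology closure_of C = ?V"
  proof -
    have "\<exists>y\<in>C. y \<in> N.metric.mball x \<epsilon>" if x: "x \<in> ?V" and "0 < \<epsilon>" for x \<epsilon>
    proof -
      obtain m y where y: "\<forall>i<m. y i \<in> D" "\<forall>i\<ge>m. y i = 0" "gauge_norm (x - y) < \<epsilon>"
        using gauge_norm_dense[OF x \<open>0 < \<epsilon>\<close> D] by blast
      then have "y \<in> C"
        by (auto simp: C_def)
      then show ?thesis
        using y(3) x C_V by (intro bexI[of _ y]) (auto simp: N.ndist_def)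
    qed
    then show ?thesis
      by (auto simp: N.metric.metric_closure_of)
  qed
  have C_span: "C \<subseteq> N.span (range unit_seq)"
  proof
    fix y assume "y \<in> C"
    then obtain m where m: "\<And>i. m \<le> i \<Longrightarrow> y i = 0"
      by (auto simp: C_def)
    have "y = (\<Sum>i<m. seq_scale (y i) (unit_seq i))"
      using m by (intro ext) (auto simp: sum_scale_unit_seq_apply not_less)
    then show "y \<in> N.span (range unit_seq)"
      by (metis (no_types, lifting) N.span_sum N.span_scale N.span_base rangeI)
  qed
  have "countable C"
  proof (rule countable_subset)
    show "C \<subseteq> (\<lambda>l i. if i < length l then l ! i else 0) ` lists D"
    proof
      fix y assume "y \<in> C"
      then obtain m where m: "\<forall>i<m. y i \<in> D" "\<forall>i\<ge>m. y i = 0"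
        by (auto simp: C_def)
      then show "y \<in> (\<lambda>l i. if i < length l then l ! i else 0) ` lists D"
        by (intro image_eqI[of _ _ "map y [0..<m]"]) auto
    qed
    show "countable ((\<lambda>l i. if i < length l then l ! i else 0) ` lists D)"
      using \<open>countable D\<close> by simp
  qed
  have in_V: "unit_seq i \<in> ?V" for i
    by (rule unit_seq_vanishing_tails)
  have functional: "N.bounded_functional (\<lambda>x. x i)" for i
    using norm_le_gauge_norm
    by (auto simp: N.bounded_functional_def seq_scale_def intro!: exI[of _ 1])
  have dual: "N.dual_norm (\<lambda>x. x i) = 1" for i
    unfolding N.dual_norm_def
  proof (rule cSup_eq_maximum)
    show "1 \<in> (\<lambda>x. norm (x i)) ` {x \<in> ?V. gauge_norm x \<le> 1}"
      by (intro image_eqI[of _ _ "unit_seq i"])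
        (simp_all add: in_V gauge_norm_unit_seq, simp add: unit_seq_def)
    show "r \<le> 1" if "r \<in> (\<lambda>x. norm (x i)) ` {x \<in> ?V. gauge_norm x \<le> 1}" for r
      using that norm_le_gauge_norm by (auto intro: order_trans)
  qed
  show ?thesis
  proof
    show "N.metric.mcomplete"
      unfolding N.metric.mcomplete_def
    proof (intro allI impI)
      fix \<sigma> assume \<sigma>: "N.metric.MCauchy \<sigma>"
      then have V: "\<sigma> n \<in> ?V" for n
        by (auto simp: N.metric.MCauchy_def)
      have "\<exists>x\<in>?V. \<forall>\<epsilon>>0. \<exists>N. \<forall>n\<ge>N. gauge_norm (\<sigma> n - x) < \<epsilon>"
        using \<sigma> V by (intro gauge_norm_complete) (auto simp: N.metric.MCauchy_def N.ndist_def)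
      then show "\<exists>x. limitin N.metric.mtopology \<sigma> x sequentially"
        using V by (auto simp: N.metric.limit_metric_sequentially N.ndist_def)
    qed
    show "separable_space N.metric.mtopology"
      using \<open>countable C\<close> C_V C_dense unfolding separable_space_def by auto
    show "\<not> (\<exists>B. finite B \<and> B \<subseteq> ?V \<and> ?V \<subseteq> N.span B)"
    proof
      assume "\<exists>B. finite B \<and> B \<subseteq> ?V \<and> ?V \<subseteq> N.span B"
      then obtain B where B: "finite B" "?V \<subseteq> N.span B"
        by blast
      \<comment> \<open>A finite spanning set bounds the size of every independent set.\<close>
      have "N.independent (range unit_seq)"
        unfolding N.independent_explicit_module
      proof (intro allI impI)
        fix t u v
        assume t: "finite t" "t \<subseteq> range unit_seq" "v \<in> t"
          and zero: "(\<Sum>v\<in>t. seq_scale (u v) v) = 0"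
        obtain i where i: "v = unit_seq i"
          using t by blast
        have "0 = (\<Sum>w\<in>t. seq_scale (u w) w i)"
          using fun_cong[OF zero, of i] by (simp add: sum_seq_apply)
        also have "\<dots> = (\<Sum>w\<in>t. if w = v then u v else 0)"
        proof (rule sum.cong[OF refl])
          fix w assume "w \<in> t"
          then obtain j where "w = unit_seq j"
            using t(2) by blast
          then show "seq_scale (u w) w i = (if w = v then u v else 0)"
            using inj_eq[OF inj_unit_seq, of j i]
            by (cases "j = i") (auto simp: i seq_scale_def unit_seq_apply)
        qed
        finally show "u v = 0"
          using t by simp
      qed
      moreover have "range unit_seq \<subseteq> N.span B"
        using B(2) in_V by auto
      ultimately have "finite (range (unit_seq :: nat \<Rightarrow> nat \<Rightarrow> 'f))"
        using N.independent_span_bound[OF B(1)] by blast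
      then show False
        using finite_imageD[OF _ inj_unit_seq] by blast
    qed
    show "unit_seq i \<in> ?V" for i
      by (rule in_V)
    show "N.bounded_functional (\<lambda>x. x i)" for i
      by (rule functional)
    show "N.metric.mtopology closure_of (N.span (range unit_seq)) = ?V"
      using closure_of_mono[OF C_span, of N.metric.mtopology] closure_of_subset_topspace C_dense
      by (metis N.metric.topspace_mtopology subset_antisym)
    show "unit_seq i k = (if k = i then 1 else 0)" for i k
      by (simp add: unit_seq_def)
    show "0 < (INF i. min (gauge_norm (unit_seq i :: nat \<Rightarrow> 'f))
        (N.dual_norm (\<lambda>x. x i)))"
      by (simp add: dual gauge_norm_unit_seq)
    show "bdd_above (range (\<lambda>i. max (gauge_norm (unit_seq i :: nat \<Rightarrow> 'f))
        (N.dual_norm (\<lambda>x. x i))))"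
      by (simp add: dual gauge_norm_unit_seq)
    show "x = 0" if "\<And>i. x i = 0" for x :: "nat \<Rightarrow> 'f"
      using that by (intro ext) simp
    have "gauge_norm (\<Sum>i\<le>m. seq_scale (x i) (unit_seq i)) \<le> 1 * gauge_norm x" if "x \<in> ?V" for x m
      using gauge_norm_mono[OF that, of "\<Sum>i\<le>m. seq_scale (x i) (unit_seq i)"]
      by (simp add: sum_scale_unit_seq_apply)
    then show "\<exists>C>0. \<forall>x\<in>?V. \<forall>m. gauge_norm (\<Sum>i\<le>m. seq_scale (x i) (unit_seq i))
        \<le> C * gauge_norm x"
      using zero_less_one by blast
  qed
qed

end


section \<open>Signed indicators\<close>

lemma signed_indicator_unit_seq_apply:
  assumes "finite A"
  shows "signed_indicator seq_scale unit_seq \<epsilon> A i = (if i \<in> A then \<epsilon> i else 0)"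
  unfolding signed_indicator_def by (rule sum_scale_unit_seq_apply[OF assms])

lemma signed_indicator_one:
  "signed_indicator seq_scale unit_seq (\<lambda>_. 1) A = (\<Sum>i\<in>A. unit_seq i)"
  unfolding signed_indicator_def by (simp add: seq_scale_def)

context gauge_family
begin

lemma signed_indicator_vanishing_tails:
  fixes \<epsilon> :: "nat \<Rightarrow> 'f::real_normed_field"
  assumes "finite A"
  shows "signed_indicator seq_scale unit_seq \<epsilon> A \<in> vanishing_tails"
proof (rule finite_support_vanishing_tails)
  fix i assume "Suc (Max A) \<le> i"
  then have "i \<notin> A"
    using assms Max_ge[of A i] by fastforce
  then show "signed_indicator seq_scale unit_seq \<epsilon> A i = 0"
    using assms by (simp add: signed_indicator_unit_seq_apply)
qed

lemma sum_norm_signed_indicator: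
  fixes \<epsilon> :: "nat \<Rightarrow> 'f::real_normed_field"
  assumes "finite A" "finite B" "\<epsilon> \<in> signs B"
  shows "(\<Sum>i\<in>A. norm (signed_indicator seq_scale unit_seq \<epsilon> B i)) = card (A \<inter> B)"
proof -
  have "(\<Sum>i\<in>A. norm (signed_indicator seq_scale unit_seq \<epsilon> B i)) = (\<Sum>i\<in>A. if i \<in> B then 1 else 0)"
    using assms by (intro sum.cong) (auto simp: signed_indicator_unit_seq_apply signs_def)
  also have "\<dots> = card (A \<inter> B)"
    using assms(1) by (simp add: sum.inter_restrict[symmetric])
  finally show ?thesis .
qed

lemma gauge_norm_signed_indicator_le:
  fixes \<epsilon> :: "nat \<Rightarrow> 'f::real_normed_field"
  assumes "finite B" "\<epsilon> \<in> signs B" "\<And>A d. (A, d) \<in> F \<Longrightarrow> real (card (A \<inter> B)) \<le> c * d"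
  shows "gauge_norm (signed_indicator seq_scale unit_seq \<epsilon> B) \<le> c"
  using assms finite_set by (intro gauge_norm_le) (simp add: sum_norm_signed_indicator)

lemma card_le_gauge_norm_signed_indicator:
  fixes \<epsilon> :: "nat \<Rightarrow> 'f::real_normed_field"
  assumes "(B, d) \<in> F" "\<epsilon> \<in> signs B"
  shows "real (card B) \<le> gauge_norm (signed_indicator seq_scale unit_seq \<epsilon> B) * d"
  using sum_le_gauge_norm[OF signed_indicator_vanishing_tails assms(1), of B \<epsilon>] assms finite_set
  by (simp add: sum_norm_signed_indicator)

text \<open>
  As \<open>x\<close> and the signed indicator of \<open>B\<close> have disjoint supports, each of them is dominated in modulus
  by their sum, so monotonicity bounds both norms by that of the sum.
\<close>

lemma symmetric_for_largest_coefficients_gauge: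
  assumes bounds: "\<And>A B (\<epsilon> :: nat \<Rightarrow> 'f::real_normed_field) (\<epsilon>' :: nat \<Rightarrow> 'f).
      finite A \<Longrightarrow> finite B \<Longrightarrow> card A \<le> card B \<Longrightarrow> card A \<in> range n \<Longrightarrow> card B \<in> range n \<Longrightarrow>
      \<epsilon> \<in> signs A \<Longrightarrow> \<epsilon>' \<in> signs B \<Longrightarrow>
      gauge_norm (signed_indicator seq_scale unit_seq \<epsilon> A)
        \<le> gauge_norm (signed_indicator seq_scale unit_seq \<epsilon>' B)"
  shows "symmetric_for_largest_coefficients n seq_scale (vanishing_tails :: (nat \<Rightarrow> 'f) set)
    gauge_norm unit_seq (\<lambda>i x. x i)"
  unfolding symmetric_for_largest_coefficients_def
proof (intro exI[of _ 2] conjI allI impI ballI)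
  fix A B and \<epsilon> \<epsilon>' x :: "nat \<Rightarrow> 'f"
  assume AB: "finite A \<and> finite B \<and> card A \<le> card B \<and> A \<inter> B = {} \<and>
      card A \<in> range n \<and> card B \<in> range n"
    and signs: "\<epsilon> \<in> signs A" "\<epsilon>' \<in> signs B" and x: "x \<in> vanishing_tails"
    and supp: "(\<forall>i. norm (x i) \<le> 1) \<and> supp (\<lambda>i x. x i) x \<inter> (A \<union> B) = {}"
  let ?A = "signed_indicator seq_scale unit_seq \<epsilon> A"
  let ?B = "signed_indicator seq_scale unit_seq \<epsilon>' B"
  have xB: "x + ?B \<in> vanishing_tails"
    using AB x by (intro vanishing_tails_add signed_indicator_vanishing_tails) auto
  have disjoint: "x i = 0" if "i \<in> B" for i
    using supp that by (auto simp: supp_def)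
  have "gauge_norm (x + ?A) \<le> gauge_norm x + gauge_norm ?A"
    using AB x by (intro gauge_norm_triangle signed_indicator_vanishing_tails) auto
  moreover have "gauge_norm x \<le> gauge_norm (x + ?B)"
    by (rule gauge_norm_mono[OF xB])
      (use AB disjoint in \<open>auto simp: signed_indicator_unit_seq_apply\<close>)
  moreover have "gauge_norm ?A \<le> gauge_norm ?B"
    using AB signs by (intro bounds) auto
  moreover have "gauge_norm ?B \<le> gauge_norm (x + ?B)"
    by (rule gauge_norm_mono[OF xB])
      (use AB disjoint in \<open>auto simp: signed_indicator_unit_seq_apply\<close>)
  ultimately show "gauge_norm (x + ?A) \<le> 2 * gauge_norm (x + ?B)"
    by linarith
qed simp

end

section \<open>A family that separates sizes inside the gaps\<close>

text \<open>
  The numbers \<open>q\<close> and \<open>k\<close> are left free, so that no sequence of gaps has to be chosen; overlaps between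
  the sets are harmless.
\<close>

definition gap_family :: "(nat \<Rightarrow> nat) \<Rightarrow> (nat set \<times> real) set"
  where "gap_family n =
    {(A, sqrt (card A)) | A. finite A \<and> A \<noteq> {}} \<union>
    {((\<lambda>i. 2 * i) ` {..<q\<^sup>2 * n k}, sqrt (n k)) | q k. q ^ 4 * n k \<le> n (Suc k)}"

lemma gap_familyE:
  assumes "(A, d) \<in> gap_family n"
  obtains "finite A" "A \<noteq> {}" "d = sqrt (card A)"
    | q k where "A = (\<lambda>i. 2 * i) ` {..<q\<^sup>2 * n k}" "d = sqrt (n k)" "q ^ 4 * n k \<le> n (Suc k)"
  using assms unfolding gap_family_def by blast

lemma gap_family_finite_setI:
  "finite A \<Longrightarrow> A \<noteq> {} \<Longrightarrow> (A, sqrt (card A)) \<in> gap_family n"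
  unfolding gap_family_def by blast

lemma gap_family_evensI:
  "q ^ 4 * n k \<le> n (Suc k) \<Longrightarrow>
    ((\<lambda>i. 2 * i) ` {..<q\<^sup>2 * n k}, sqrt (n k)) \<in> gap_family n"
  unfolding gap_family_def by blast

lemma gauge_family_gap_family:
  assumes "\<forall>k. 0 < n k"
  shows "gauge_family (gap_family n)"
proof
  fix A d assume "(A, d) \<in> gap_family n"
  then show "finite A"
    by (cases rule: gap_familyE) auto
next
  fix A d assume "(A, d) \<in> gap_family n"
  then show "1 \<le> d"
  proof (cases rule: gap_familyE)
    case 1
    then show ?thesis
      by (simp add: Suc_leI card_gt_0_iff)
  next
    case (2 q k)
    then show ?thesis
      using assms by (simp add: Suc_leI)
  qed
next
  show "({i}, 1) \<in> gap_family n" for i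
    using gap_family_finite_setI[of "{i}" n] by simp
qed

lemma real_le_sqrt_mult_sqrt: "a \<le> b \<Longrightarrow> a \<le> c \<Longrightarrow> 0 \<le> a \<Longrightarrow> a \<le> sqrt b * sqrt c"
  by (smt (verit) mult_mono real_sqrt_ge_zero real_sqrt_le_mono real_sqrt_mult_self)

text \<open>
  Every member of the family respects the square root growth on sets whose size is a term of the
  sequence. For the added sets, the size of \<open>B\<close> is either at most \<open>n\<^sub>k\<close>, where \<open>B\<close> is too small to notice
  the reduced weight, or at least \<open>n\<^bsub>k+1\<^esub>\<close>, where even the whole added set gives no more than \<open>\<surd>\<bar>B\<bar>\<close>.
\<close>

lemma card_Int_le_gap_family:
  assumes "strict_mono n" "(A, d) \<in> gap_family n" "finite B" "card B \<in> range n"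
  shows "real (card (A \<inter> B)) \<le> sqrt (card B) * d"
  using assms(2)
proof (cases rule: gap_familyE)
  case 1
  then have "card (A \<inter> B) \<le> card A" "card (A \<inter> B) \<le> card B"
    using assms(3) by (auto intro: card_mono)
  then show ?thesis
    unfolding \<open>d = sqrt (card A)\<close> by (intro real_le_sqrt_mult_sqrt) auto
next
  case (2 q k)
  obtain l where l: "card B = n l"
    using assms(4) by auto
  show ?thesis
  proof (cases "l \<le> k")
    case True
    then have "card B \<le> n k"
      using assms(1) l by (simp add: strict_mono_less_eq)
    moreover have "card (A \<inter> B) \<le> card B"
      using assms(3) by (auto intro: card_mono)
    ultimately show ?thesis
      unfolding \<open>d = sqrt (n k)\<close> by (intro real_le_sqrt_mult_sqrt) auto
  next
    case False
    then have "n (Suc k) \<le> card B"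
      using assms(1) l by (simp add: strict_mono_less_eq)
    then have "q ^ 4 * n k \<le> card B"
      using 2(3) by linarith
    then have le: "sqrt (real (q ^ 4 * n k)) * sqrt (n k) \<le> sqrt (card B) * sqrt (n k)"
      by (intro mult_right_mono) (auto simp del: of_nat_mult)
    have "card (A \<inter> B) \<le> card A"
      using 2(1) by (auto intro!: card_mono)
    also have "\<dots> = q\<^sup>2 * n k"
      unfolding 2(1) by (subst card_image) (auto intro: inj_onI)
    finally have "real (card (A \<inter> B)) \<le> q\<^sup>2 * n k"
      using of_nat_le_iff by blast
    also have "\<dots> = sqrt (real (q ^ 4 * n k)) * sqrt (n k)"
    proof -
      have "sqrt (real (q ^ 4 * n k)) = sqrt ((real q ^ 2)\<^sup>2) * sqrt (n k)"
        by (simp add: real_sqrt_mult flip: power_mult)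
      also have "\<dots> = real q ^ 2 * sqrt (n k)"
        by (simp only: real_sqrt_abs) simp
      finally show ?thesis
        by simp
    qed
    finally show ?thesis
      using le 2(2) by simp
  qed
qed

lemma arbitrarily_large_quotient_gapsD:
  assumes "arbitrarily_large_quotient_gaps n" "\<forall>k. 0 < n k"
  shows "\<exists>k. q * n k \<le> n (Suc k)"
proof (rule ccontr)
  assume neg: "\<nexists>k. q * n k \<le> n (Suc k)"
  have "real (n (Suc k)) / real (n k) \<le> q" for k
  proof -
    have "n (Suc k) \<le> q * n k"
      using neg by (meson linear)
    then have "real (n (Suc k)) \<le> real q * real (n k)"
      by (metis of_nat_le_iff of_nat_mult)
    then show ?thesis
      using assms(2) by (simp add: divide_le_eq)
  qed
  then have "limsup (\<lambda>k. ereal (real (n (Suc k)) / real (n k))) \<le> ereal q"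
    by (intro Limsup_bounded) auto
  then show False
    using assms(1) by (simp add: arbitrarily_large_quotient_gaps_def)
qed

text \<open>
  The failure of democracy is witnessed by the first \<open>q\<^sup>2 n\<^sub>k\<close> even and the first \<open>q\<^sup>2 n\<^sub>k\<close> odd numbers: their
  indicators have norms with quotient at least \<open>q\<close>.
\<close>

lemma gap_family_counterexample:
  fixes n :: "nat \<Rightarrow> nat"
  assumes mono: "strict_mono n" and pos: "\<forall>k. 0 < n k"
    and gaps: "arbitrarily_large_quotient_gaps n"
  shows "\<exists>(V :: (nat \<Rightarrow> 'f::{real_normed_field, banach, second_countable_topology}) set) nrm e es.
      schauder_basis seq_scale V nrm e es \<and>
      symmetric_for_largest_coefficients n seq_scale V nrm e es \<and>
      \<not> democratic nrm e"
proof -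
  interpret gauge_family "gap_family n"
    by (rule gauge_family_gap_family[OF pos])
  let ?ind = "signed_indicator seq_scale unit_seq :: (nat \<Rightarrow> 'f) \<Rightarrow> nat set \<Rightarrow> nat \<Rightarrow> 'f"
  have upper: "gauge_norm (?ind \<epsilon> A) \<le> sqrt (card A)"
    if "finite A" "card A \<in> range n" "\<epsilon> \<in> signs A" for A \<epsilon>
    using that card_Int_le_gap_family[OF mono] by (intro gauge_norm_signed_indicator_le) auto
  have lower: "sqrt (card B) \<le> gauge_norm (?ind \<epsilon> B)"
    if "finite B" "B \<noteq> {}" "\<epsilon> \<in> signs B" for B \<epsilon>
  proof -
    have "sqrt (card B) * sqrt (card B) \<le> gauge_norm (?ind \<epsilon> B) * sqrt (card B)"
      using card_le_gauge_norm_signed_indicator[OF gap_family_finite_setI[OF that(1,2)] that(3)]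
      by simp
    then show ?thesis
      by (rule mult_right_le_imp_le) (use that in \<open>simp add: card_gt_0_iff\<close>)
  qed
  have "symmetric_for_largest_coefficients n seq_scale (vanishing_tails :: (nat \<Rightarrow> 'f) set)
      gauge_norm unit_seq (\<lambda>i x. x i)"
  proof (rule symmetric_for_largest_coefficients_gauge)
    fix A B and \<epsilon> \<epsilon>' :: "nat \<Rightarrow> 'f"
    assume *: "finite A" "finite B" "card A \<le> card B" "card A \<in> range n" "card B \<in> range n"
      "\<epsilon> \<in> signs A" "\<epsilon>' \<in> signs B"
    have "B \<noteq> {}"
      using *(5) pos by (metis card.empty imageE less_irrefl)
    then have "sqrt (card B) \<le> gauge_norm (?ind \<epsilon>' B)"
      using * by (intro lower)
    moreover have "gauge_norm (?ind \<epsilon> A) \<le> sqrt (card A)"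
      using * by (intro upper)
    moreover have "sqrt (card A) \<le> sqrt (card B)"
      using *(3) by simp
    ultimately show "gauge_norm (?ind \<epsilon> A) \<le> gauge_norm (?ind \<epsilon>' B)"
      by linarith
  qed
  moreover have "\<not> democratic gauge_norm (unit_seq :: nat \<Rightarrow> nat \<Rightarrow> 'f)"
  proof
    assume "democratic gauge_norm (unit_seq :: nat \<Rightarrow> nat \<Rightarrow> 'f)"
    then obtain C where
      C: "\<And>A B. finite A \<Longrightarrow> finite B \<Longrightarrow> card A \<le> card B \<Longrightarrow>
        gauge_norm (?ind (\<lambda>_. 1) A) \<le> C * gauge_norm (?ind (\<lambda>_. 1) B)"
      and "0 < C"
      unfolding democratic_def signed_indicator_one by blast
    obtain q :: nat where q: "C < q"
      using reals_Archimedean2 by blast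
    obtain k where k: "q ^ 4 * n k \<le> n (Suc k)"
      using arbitrarily_large_quotient_gapsD[OF gaps pos] by blast
    let ?E = "(\<lambda>i. 2 * i) ` {..<q\<^sup>2 * n k}" and ?O = "(\<lambda>i. 2 * i + 1) ` {..<q\<^sup>2 * n k}"
    have card: "card ?E = q\<^sup>2 * n k" "card ?O = q\<^sup>2 * n k"
      by (subst card_image; auto intro: inj_onI)+
    have signs: "(\<lambda>_. 1 :: 'f) \<in> signs A" for A
      by (simp add: signs_def)
    have nk: "0 < sqrt (n k)"
      using pos by simp
    have "sqrt (n k) * (q\<^sup>2 * sqrt (n k)) = card ?E"
      by (simp add: card)
    also have "\<dots> \<le> sqrt (n k) * gauge_norm (?ind (\<lambda>_. 1) ?E)"
      using card_le_gauge_norm_signed_indicator[OF gap_family_evensI[OF k] signs]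
      by (simp add: mult.commute)
    finally have "q\<^sup>2 * sqrt (n k) \<le> gauge_norm (?ind (\<lambda>_. 1) ?E)"
      using nk by simp
    also have "\<dots> \<le> C * gauge_norm (?ind (\<lambda>_. 1) ?O)"
      by (rule C) (simp_all only: card finite_imageI finite_lessThan order_refl)
    also have "gauge_norm (?ind (\<lambda>_. 1) ?O) \<le> q * sqrt (n k)"
    proof (intro gauge_norm_signed_indicator_le signs)
      fix A d assume "(A, d) \<in> gap_family n"
      then show "real (card (A \<inter> ?O)) \<le> q * sqrt (n k) * d"
      proof (cases rule: gap_familyE)
        case 1
        then have "card (A \<inter> ?O) \<le> card A" "card (A \<inter> ?O) \<le> card ?O"
          by (auto intro!: card_mono)
        then have "real (card (A \<inter> ?O)) \<le> sqrt (card ?O) * sqrt (card A)"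
          by (intro real_le_sqrt_mult_sqrt) (auto simp del: of_nat_mult)
        then show ?thesis
          using 1(3) unfolding card by (simp add: real_sqrt_mult)
      next
        case (2 r l)
        then have "A \<inter> ?O = {}"
          by auto presburger
        then show ?thesis
          using 2 by simp
      qed
    qed simp
    finally have "real q * (q * sqrt (n k)) \<le> C * (q * sqrt (n k))"
      using \<open>0 < C\<close> by (simp add: power2_eq_square)
    then show False
      using q \<open>0 < C\<close> nk by simp
  qed
  ultimately show ?thesis
    using schauder_basis_gauge by blast
qed

theorem proposition4p12:
  fixes n :: "nat \<Rightarrow> nat"
  assumes "strict_mono n" and "\<forall>k. 0 < n k"
    and "arbitrarily_large_quotient_gaps n"
  shows "(\<exists>(V :: (nat \<Rightarrow> real) set) nrm e es.
            schauder_basis seq_scale V nrm e es \<and>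
            symmetric_for_largest_coefficients n seq_scale V nrm e es \<and>
            \<not> democratic nrm e) \<and>
         (\<exists>(V :: (nat \<Rightarrow> complex) set) nrm e es.
            schauder_basis seq_scale V nrm e es \<and>
            symmetric_for_largest_coefficients n seq_scale V nrm e es \<and>
            \<not> democratic nrm e)"
  by (intro conjI gap_family_counterexample assms)

end
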